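(* Let $p\equiv1\pmod{12}$ be prime with $p=m^2+n^2$ for integers $m,n$ with $3\mid n$, and let $b$ be a positive integer. For integers $k$ let \[ \alpha_k=3bp+3kmp-\tfrac{(m+n)p}{2}+\tfrac{3p^2}{2},\quad \beta_k=3knp+\tfrac{(m-n)p}{2}+\tfrac{3p^2}{2},\quad \gamma_k=3bkm+\tfrac{k(3k-1)p}{2}. \] (1) If $m\equiv1\pmod3$, then \[ Q(q^{bm},q^p)Q(q^{bn},q^p)=\sum_{k=0}^{p-1}q^{\gamma_k}\,Q\big(q^{(\alpha_k-p^2)/3},q^{p^2}\big)\,Q\big(q^{(2p^2-\beta_k)/3},q^{p^2}\big). \] (2) If $m\equiv2\pmod3$, then \[ Q(q^{bm},q^p)Q(q^{bn},q^p)=\sum_{k=0}^{p-1}q^{\gamma_k}\,Q\big(q^{(2p^2-\alpha_k)/3},q^{p^2}\big)\,Q\big(q^{(\beta_k-p^2)/3},q^{p^2}\big). \]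
   Context: For complex $z\neq0$ and $0<|q|<1$: $(z;q)_\infty=\prod_{j\ge0}(1-zq^j)$, $(a_1,\dots,a_j;q)_\infty=\prod_i(a_i;q)_\infty$, and the quintuple product is $Q(z,q)=(z,q/z,q;q)_\infty(qz^2,q/z^2;q^2)_\infty$. In each case the exponents $(\alpha_k-p^2)/3$, $(2p^2-\beta_k)/3$ (resp. $(2p^2-\alpha_k)/3$, $(\beta_k-p^2)/3$) are integers. *)

theory Defs
  imports "HOL-Analysis.Analysis" "HOL-Number_Theory.Cong"
begin

definition qpoch :: "complex \<Rightarrow> complex \<Rightarrow> complex" where
  "qpoch z q = (\<Prod>j. 1 - z * q ^ j)"

lemma convergent_prod_qpoch:
  fixes z q :: complex
  assumes "norm q < 1"
  shows "convergent_prod (\<lambda>j. 1 - z * q ^ j)"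
proof -
  have "summable (\<lambda>j. norm z * norm q ^ j)"
    using assms by (intro summable_mult summable_geometric) auto
  then have "abs_convergent_prod (\<lambda>j. 1 - z * q ^ j)"
    by (intro summable_imp_abs_convergent_prod) (simp add: norm_mult norm_power)
  then show ?thesis
    by (rule abs_convergent_prod_imp_convergent_prod)
qed

definition qpoch_list :: "complex list \<Rightarrow> complex \<Rightarrow> complex" where
  "qpoch_list as q = (\<Prod>a\<leftarrow>as. qpoch a q)"

definition quintuple :: "complex \<Rightarrow> complex \<Rightarrow> complex" where
  "quintuple z q = qpoch_list [z, q / z, q] q * qpoch_list [q * z\<^sup>2, q / z\<^sup>2] (q\<^sup>2)"

definition alpha :: "nat \<Rightarrow> int \<Rightarrow> int \<Rightarrow> int \<Rightarrow> int \<Rightarrow> rat" where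
  "alpha p m n b k =
     3 * of_int b * of_nat p + 3 * of_int k * of_int m * of_nat p
       - (of_int m + of_int n) * of_nat p / 2 + 3 * (of_nat p)\<^sup>2 / 2"

definition beta :: "nat \<Rightarrow> int \<Rightarrow> int \<Rightarrow> int \<Rightarrow> rat" where
  "beta p m n k =
     3 * of_int k * of_int n * of_nat p
       + (of_int m - of_int n) * of_nat p / 2 + 3 * (of_nat p)\<^sup>2 / 2"

definition gamma :: "nat \<Rightarrow> int \<Rightarrow> int \<Rightarrow> int \<Rightarrow> rat" where
  "gamma p m b k =
     3 * of_int b * of_int k * of_int m + of_int k * (3 * of_int k - 1) * of_nat p / 2"

text \<open>
  The following facts show that the floor function is only a coercion from rationals to
  integers when it is applied to the exponents: they are all integral.
\<close>

lemma gamma_Ints: "gamma p m b k \<in> \<int>"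
proof -
  have "even (k * (3 * k - 1))"
    by simp
  then obtain t where t: "k * (3 * k - 1) = 2 * t"
    by blast
  have "of_int k * (3 * of_int k - 1) = (2 * of_int t :: rat)"
    using arg_cong[OF t, of "of_int :: int \<Rightarrow> rat"] by simp
  then have "gamma p m b k = of_int (3 * b * k * m + t * int p)"
    by (simp add: gamma_def)
  then show ?thesis
    by (metis Ints_of_int)
qed

lemma six_dvd_Ints:
  assumes "6 dvd int p - x"
  shows "of_nat p * (of_nat p - of_int x) / 6 \<in> (\<int> :: rat set)"
proof -
  from assms obtain t where t: "int p - x = 6 * t"
    by blast
  have "of_nat p - of_int x = (6 * of_int t :: rat)"
    using arg_cong[OF t, of "of_int :: int \<Rightarrow> rat"] by simp
  then have "of_nat p * (of_nat p - of_int x) / 6 = (of_int (int p * t) :: rat)"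
    by simp
  then show ?thesis
    by (metis Ints_of_int)
qed

context
  fixes p :: nat and m n :: int
  assumes p: "[p = 1] (mod 12)" and pmn: "int p = m\<^sup>2 + n\<^sup>2" and n: "3 dvd n"
begin

lemma odd_mn: "odd (m + n)"
proof -
  have "odd p"
    using p unfolding cong_def by presburger
  then have "odd (m\<^sup>2 + n\<^sup>2)"
    by (metis pmn even_of_nat)
  then show ?thesis
    by simp
qed

lemma six_dvd_sub:
  assumes "[m = 1] (mod 3)"
  shows "6 dvd int p - (m + n)" "6 dvd int p - (m - n)"
proof -
  have "p mod 12 = 1" "m mod 3 = 1"
    using p assms by (simp_all add: cong_def)
  then show "6 dvd int p - (m + n)" "6 dvd int p - (m - n)"
    using odd_mn n by presburger+
qed

lemma six_dvd_add:
  assumes "[m = 2] (mod 3)"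
  shows "6 dvd int p - - (m + n)" "6 dvd int p - - (m - n)"
proof -
  have "p mod 12 = 1" "m mod 3 = 2"
    using p assms by (simp_all add: cong_def)
  then show "6 dvd int p - - (m + n)" "6 dvd int p - - (m - n)"
    using odd_mn n by presburger+
qed

lemma exponents_Ints_1:
  assumes "[m = 1] (mod 3)"
  shows "(alpha p m n b k - (of_nat p)\<^sup>2) / 3 \<in> \<int>" "(2 * (of_nat p)\<^sup>2 - beta p m n k) / 3 \<in> \<int>"
proof -
  have "(alpha p m n b k - (of_nat p)\<^sup>2) / 3 =
      of_int (b * int p + k * m * int p) + of_nat p * (of_nat p - of_int (m + n)) / 6"
    by (simp add: alpha_def field_simps power2_eq_square)
  then show "(alpha p m n b k - (of_nat p)\<^sup>2) / 3 \<in> \<int>"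
    using six_dvd_Ints[OF six_dvd_sub(1)[OF assms]] by (metis Ints_add Ints_of_int)
  have "(2 * (of_nat p)\<^sup>2 - beta p m n k) / 3 =
      of_int (- (k * n * int p)) + of_nat p * (of_nat p - of_int (m - n)) / 6"
    by (simp add: beta_def field_simps power2_eq_square)
  then show "(2 * (of_nat p)\<^sup>2 - beta p m n k) / 3 \<in> \<int>"
    using six_dvd_Ints[OF six_dvd_sub(2)[OF assms]] by (metis Ints_add Ints_of_int)
qed

lemma exponents_Ints_2:
  assumes "[m = 2] (mod 3)"
  shows "(2 * (of_nat p)\<^sup>2 - alpha p m n b k) / 3 \<in> \<int>" "(beta p m n k - (of_nat p)\<^sup>2) / 3 \<in> \<int>"
proof -
  have "(2 * (of_nat p)\<^sup>2 - alpha p m n b k) / 3 =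
      of_int (- (b * int p + k * m * int p)) + of_nat p * (of_nat p - of_int (- (m + n))) / 6"
    by (simp add: alpha_def field_simps power2_eq_square)
  then show "(2 * (of_nat p)\<^sup>2 - alpha p m n b k) / 3 \<in> \<int>"
    using six_dvd_Ints[OF six_dvd_add(1)[OF assms]] by (metis Ints_add Ints_of_int)
  have "(beta p m n k - (of_nat p)\<^sup>2) / 3 =
      of_int (k * n * int p) + of_nat p * (of_nat p - of_int (- (m - n))) / 6"
    by (simp add: beta_def field_simps power2_eq_square)
  then show "(beta p m n k - (of_nat p)\<^sup>2) / 3 \<in> \<int>"
    using six_dvd_Ints[OF six_dvd_add(2)[OF assms]] by (metis Ints_add Ints_of_int)
qed

end

end

theory Submission
  imports Defs
begin

text \<open>
  The quintuple product has the expansion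
  $Q(z,q) = \sum_{l} c(l)\, q^{l(l-1)/6} z^l$ over all integers $l$, where $c(l) = 1, -1, 0$ for
  $l \equiv 0, 1, 2$ modulo 3. It is obtained by multiplying the theta series of $(z, q/z, q; q)$ and
  $(qz^2, q/z^2, q^2; q^2)$ given by the Jacobi triple product: the coefficient of $z^l$ in
  the product is again a theta series, in base $q^6$, and either vanishes by antisymmetry or
  is a monomial times $(q^2; q^2)$.

  The left-hand side of the theorem is then a sum over $(i,j) \in Z^2$. With
  $\epsilon = \pm 1$ chosen such that $\epsilon m \equiv 1$ modulo 3, every $(i,j)$ is uniquely
  $\epsilon(ms - nt, ns + mt) + (3k, 0)$ with $0 \le k < p$, since the rotated lattice has
  index $p = m^2 + n^2$ and $3m$ is invertible modulo $p$. This substitution preserves $c(i)c(j)$ and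
  turns the quadratic form $i^2 + j^2$ into $p(s^2 + t^2)$ plus lower-order terms, which gives the
  right-hand side termwise.
\<close>

subsection \<open>The Jacobi triple product\<close>

definition qpoch_fin :: "complex \<Rightarrow> complex \<Rightarrow> nat \<Rightarrow> complex" where
  "qpoch_fin z q n = (\<Prod>j<n. 1 - z * q ^ j)"

text \<open>Taking the q-Pascal rule as the definition avoids division by factors
  \<open>1 - q ^ j\<close>; the quotient of q-factorials is recovered in
  \<open>gauss_binomial_closed\<close>.\<close>

fun gauss_binomial :: "complex \<Rightarrow> nat \<Rightarrow> nat \<Rightarrow> complex" where
  "gauss_binomial q n 0 = 1"
| "gauss_binomial q 0 (Suc k) = 0"
| "gauss_binomial q (Suc n) (Suc k) = gauss_binomial q n k + q ^ Suc k * gauss_binomial q n (Suc k)"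

lemma gauss_binomial_eq_0: "n < k \<Longrightarrow> gauss_binomial q n k = 0"
  by (induction q n k rule: gauss_binomial.induct) auto

lemma gauss_binomial_self: "gauss_binomial q n n = 1"
  by (induction n) (auto simp: gauss_binomial_eq_0)

lemma qpoch_fin_Suc: "qpoch_fin z q (Suc n) = qpoch_fin z q n * (1 - z * q ^ n)"
  by (simp add: qpoch_fin_def)

lemma qpoch_fin_Suc_shift: "qpoch_fin z q (Suc n) = (1 - z) * qpoch_fin (z * q) q n"
  unfolding qpoch_fin_def by (subst prod.lessThan_Suc_shift) (simp add: mult.assoc)

lemma qpoch_fin_0 [simp]: "qpoch_fin z q 0 = 1"
  by (simp add: qpoch_fin_def)

text \<open>After multiplication by the two q-factorials, the two summands of the q-Pascal rule
  contribute \<open>1 - q ^ Suc k\<close> and \<open>q ^ Suc k * (1 - q ^ (n - k))\<close> times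
  \<open>qpoch_fin q q n\<close>. These weights add up to \<open>1 - q ^ Suc n\<close>, the next
  factor.\<close>

lemma gauss_binomial_closed:
  "k \<le> n \<Longrightarrow> gauss_binomial q n k * (qpoch_fin q q k * qpoch_fin q q (n - k)) = qpoch_fin q q n"
proof (induction q n k rule: gauss_binomial.induct)
  case (3 q n k)
  show ?case
  proof (cases "k = n")
    case True
    then show ?thesis by (simp add: gauss_binomial_self gauss_binomial_eq_0)
  next
    case False
    with 3 have kn: "k < n" by simp
    then obtain d where d: "n = Suc (k + d)"
      using less_imp_Suc_add by blast
    have 1: "gauss_binomial q n k * (qpoch_fin q q k * (qpoch_fin q q d * (1 - q ^ Suc d))) = qpoch_fin q q n"
      using "3.IH"(1) kn by (simp add: d Suc_diff_le qpoch_fin_Suc)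
    have 2: "gauss_binomial q n (Suc k) * (qpoch_fin q q k * (1 - q ^ Suc k) * qpoch_fin q q d) = qpoch_fin q q n"
      using "3.IH"(2) kn by (simp add: d qpoch_fin_Suc)
    have "gauss_binomial q (Suc n) (Suc k) * (qpoch_fin q q (Suc k) * qpoch_fin q q (Suc n - Suc k)) =
      (1 - q ^ Suc k) * (gauss_binomial q n k * (qpoch_fin q q k * (qpoch_fin q q d * (1 - q ^ Suc d)))) +
      q ^ Suc k * (1 - q ^ Suc d) * (gauss_binomial q n (Suc k) * (qpoch_fin q q k * (1 - q ^ Suc k) * qpoch_fin q q d))"
      by (simp add: d qpoch_fin_Suc Suc_diff_le algebra_simps)
    also have "\<dots> = qpoch_fin q q (Suc n)"
      unfolding 1 2 qpoch_fin_Suc[of _ _ n] by (simp add: d algebra_simps power_add)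
    finally show ?thesis .
  qed
qed auto

text \<open>Splitting off the factor \<open>1 - z\<close> leaves the shorter product at
  \<open>z * q\<close>, which is why the induction generalises over \<open>z\<close>. The
  coefficients of equal powers of \<open>z\<close> then combine by the q-Pascal rule.\<close>

lemma q_binomial_theorem:
  "qpoch_fin z q n = (\<Sum>k\<le>n. gauss_binomial q n k * q ^ (k choose 2) * (- z) ^ k)"
proof (induction n arbitrary: z)
  case 0
  then show ?case by (simp add: binomial_eq_0)
next
  case (Suc n)
  define f where "f = (\<lambda>k. gauss_binomial q n k * q ^ (k choose 2) * (- (z * q)) ^ k)"
  have f0: "f (Suc n) = 0" "f 0 = 1"
    by (simp_all add: f_def gauss_binomial_eq_0 binomial_eq_0)
  have ch: "Suc k choose 2 = (k choose 2) + k" for k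
    by (simp add: numeral_2_eq_2)
  have "qpoch_fin z q (Suc n) = (1 - z) * (\<Sum>k\<le>n. f k)"
    by (simp add: qpoch_fin_Suc_shift Suc f_def)
  also have "\<dots> = (\<Sum>k\<le>Suc n. f k) + (\<Sum>k\<le>n. (- z) * f k)"
    by (simp add: f0 left_diff_distrib sum_distrib_left sum_subtractf sum_negf)
  also have "\<dots> = 1 + (\<Sum>k\<le>n. f (Suc k) + (- z) * f k)"
    by (subst sum.atMost_Suc_shift) (simp add: f0 sum_subtractf sum_negf)
  also have "(\<Sum>k\<le>n. f (Suc k) + (- z) * f k) =
      (\<Sum>k\<le>n. gauss_binomial q (Suc n) (Suc k) * q ^ (Suc k choose 2) * (- z) ^ Suc k)"
  proof (rule sum.cong)
    fix k
    have "(- (z * q)) ^ j = (- z) ^ j * q ^ j" for j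
      by (metis mult_minus_left power_mult_distrib)
    then show "f (Suc k) + (- z) * f k =
        gauss_binomial q (Suc n) (Suc k) * q ^ (Suc k choose 2) * (- z) ^ Suc k"
      by (simp add: f_def ch power_add algebra_simps)
  qed simp
  also have "1 + \<dots> = (\<Sum>k\<le>Suc n. gauss_binomial q (Suc n) k * q ^ (k choose 2) * (- z) ^ k)"
    by (subst sum.atMost_Suc_shift) (simp add: binomial_eq_0)
  finally show ?case .
qed

section \<open>The finite triple product\<close>

definition theta_term :: "complex \<Rightarrow> complex \<Rightarrow> int \<Rightarrow> complex" where
  "theta_term q z l = q powi (l * (l - 1) div 2) * (- z) powi l"

text \<open>Each factor \<open>1 - z / q ^ i\<close> with i from 1 to n equals
  \<open>(- z / q ^ i) * (1 - q ^ i / z)\<close>; the powers of \<open>q\<close> taken out multiply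
  to the exponent 1 + ... + n, which is \<open>Suc n choose 2\<close>.\<close>

lemma qpoch_fin_reflect:
  assumes "q \<noteq> 0" "z \<noteq> 0"
  shows "qpoch_fin (z / q ^ n) q n * q ^ (Suc n choose 2) = (- z) ^ n * qpoch_fin (q / z) q n"
proof (induction n)
  case (Suc n)
  have ch: "Suc (Suc n) choose 2 = (Suc n choose 2) + Suc n"
    by (simp add: numeral_2_eq_2)
  have "qpoch_fin (z / q ^ Suc n) q (Suc n) * q ^ (Suc (Suc n) choose 2) =
     (1 - z / q ^ Suc n) * q ^ Suc n * (qpoch_fin (z / q ^ n) q n * q ^ (Suc n choose 2))"
    using assms by (simp add: qpoch_fin_Suc_shift ch power_add)
  also have "(1 - z / q ^ Suc n) * q ^ Suc n = (- z) * (1 - q / z * q ^ n)"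
    using assms by (simp add: field_simps)
  finally show ?case
    unfolding Suc by (simp add: qpoch_fin_Suc)
qed (simp add: numeral_2_eq_2)

lemma qpoch_fin_add: "qpoch_fin z q (n + k) = qpoch_fin z q n * qpoch_fin (z * q ^ n) q k"
  by (induction k) (simp_all add: qpoch_fin_Suc power_add mult.assoc)

lemma two_int_choose_two: "2 * int (k choose 2) = int k * (int k - 1)"
proof (induction k)
  case (Suc k)
  have "Suc k choose 2 = (k choose 2) + k"
    by (simp add: numeral_2_eq_2)
  with Suc show ?case
    by (simp add: algebra_simps)
qed (simp add: numeral_2_eq_2)

lemma finite_triple_product:
  assumes "q \<noteq> 0" "z \<noteq> 0"
  shows "qpoch_fin z q n * qpoch_fin (q / z) q n =
    (\<Sum>l\<in>{- int n..int n}. theta_term q z l * gauss_binomial q (2 * n) (nat (int n + l)))"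
proof -
  let ?w = "z / q ^ n"
  have pow: "q powi i * q powi j = q powi (i + j)" for i j
    using assms by (simp add: power_int_add)
  have zpow: "(-z) powi i * (-z) powi j = (-z) powi (i + j)" for i j
    using assms by (simp add: power_int_add)
  \<comment> \<open>The \<open>q\<close>-binomial theorem at \<open>z / q ^ n\<close> with \<open>2 * n\<close> factors, recentred at the middle term.\<close>
  have "(- z) ^ n * (qpoch_fin z q n * qpoch_fin (q / z) q n) =
      qpoch_fin ?w q (2 * n) * q ^ (Suc n choose 2)"
    using qpoch_fin_reflect[OF assms, of n] assms
    by (simp add: mult_2 qpoch_fin_add)
  also have "\<dots> = (\<Sum>k\<le>2*n. gauss_binomial q (2 * n) k * q ^ (k choose 2) * (- ?w) ^ k * q ^ (Suc n choose 2))"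
    by (simp add: q_binomial_theorem sum_distrib_right)
  also have "\<dots> = (\<Sum>l\<in>{- int n..int n}. (- z) ^ n * (theta_term q z l * gauss_binomial q (2 * n) (nat (int n + l))))"
  proof (rule sum.reindex_bij_witness[of _ "\<lambda>l. nat (int n + l)" "\<lambda>k. int k - int n"])
    fix k assume "k \<in> {..2 * n}"
    let ?l = "int k - int n"
    have w: "(- ?w) ^ k = (- z) powi int k * q powi (- (int n * int k))"
    proof -
      have "- ?w = (- z) / q ^ n" by simp
      then have "(- ?w) ^ k = (- z) ^ k / q ^ (n * k)"
        by (simp only: power_divide power_mult)
      moreover have "q powi (- (int n * int k)) = 1 / q ^ (n * k)"
        by (simp only: power_int_minus_divide power_int_of_nat flip: of_nat_mult)
      ultimately show ?thesis by simp
    qed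
    have "?l * (?l - 1) = 2 * (int (k choose 2) + (- (int n * int k)) + int (Suc n choose 2))"
      using two_int_choose_two[of k] two_int_choose_two[of "Suc n"] by (simp add: algebra_simps)
    then have e: "?l * (?l - 1) div 2 = int (k choose 2) + (- (int n * int k)) + int (Suc n choose 2)"
      by simp
    have "q ^ (k choose 2) * (- ?w) ^ k * q ^ (Suc n choose 2) =
       (q powi int (k choose 2) * q powi (- (int n * int k)) * q powi int (Suc n choose 2)) * (- z) powi int k"
      unfolding w by (simp only: power_int_of_nat mult_ac)
    also have "\<dots> = q powi (?l * (?l - 1) div 2) * ((- z) powi int n * (- z) powi ?l)"
      by (simp only: pow e zpow) simp
    finally show "(- z) ^ n * (theta_term q z ?l * gauss_binomial q (2 * n) (nat (int n + ?l))) =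
        gauss_binomial q (2 * n) k * q ^ (k choose 2) * (- ?w) ^ k * q ^ (Suc n choose 2)"
      by (simp add: theta_term_def mult_ac)
  qed auto
  finally show ?thesis
    using assms by (simp flip: sum_distrib_left)
qed

section \<open>Passage to the limit in the finite triple product\<close>

text \<open>Tannery's theorem: an absolutely convergent sum is an integral against counting measure,
  so Lebesgue's dominated convergence theorem applies.\<close>

lemma dominated_convergence_infsum:
  fixes f :: "nat \<Rightarrow> 'a \<Rightarrow> complex"
  assumes "g summable_on A" "\<And>n x. x \<in> A \<Longrightarrow> norm (f n x) \<le> g x"
    and "\<And>x. x \<in> A \<Longrightarrow> (\<lambda>n. f n x) \<longlonglongrightarrow> h x"
  shows "(\<lambda>n. infsum (f n) A) \<longlonglongrightarrow> infsum h A"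
proof -
  have h: "norm (h x) \<le> g x" if "x \<in> A" for x
    using assms(2,3)[OF that] by (intro LIMSEQ_le_const2[OF tendsto_norm]) auto
  have abs: "(\<lambda>x. norm (f n x)) summable_on A" "(\<lambda>x. norm (h x)) summable_on A" for n
    by (rule Infinite_Sum.abs_summable_on_comparison_test'[OF assms(1)], use assms(2) h in blast)+
  have g: "(\<lambda>x. norm (g x)) summable_on A"
    using assms(1) by (rule summable_on_iff_abs_summable_on_real[THEN iffD1])
  have eq: "infsum u A = integral\<^sup>L (count_space A) u" if "(\<lambda>x. norm (u x)) summable_on A" for u :: "'a \<Rightarrow> complex"
    using infsetsum_infsum[of u A] that by (simp add: abs_summable_equivalent infsetsum_def)
  have "(\<lambda>n. integral\<^sup>L (count_space A) (f n)) \<longlonglongrightarrow> integral\<^sup>L (count_space A) h"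
  proof (rule integral_dominated_convergence[where w = g])
    show "integrable (count_space A) g"
      using g abs_summable_equivalent[of g A] by (simp add: Infinite_Set_Sum.abs_summable_on_def)
  qed (use assms in \<open>auto simp: AE_count_space\<close>)
  then show ?thesis
    using eq abs by simp
qed

text \<open>The ratio of consecutive terms is \<open>x ^ n * r\<close>, which tends to 0 however
  large \<open>r\<close> is.\<close>

lemma summable_theta_nat:
  fixes x r :: real
  assumes "0 < x" "x < 1" "0 < r"
  shows "summable (\<lambda>n. x ^ (n choose 2) * r ^ n)"
proof -
  have ch: "Suc n choose 2 = (n choose 2) + n" for n
    by (simp add: numeral_2_eq_2)
  have "(\<lambda>n. x ^ n * r) \<longlonglongrightarrow> 0 * r"
    using assms by (intro tendsto_mult LIMSEQ_realpow_zero) auto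
  then have "eventually (\<lambda>n. x ^ n * r < 1/2) sequentially"
    by (rule order_tendstoD) simp
  then obtain N where N: "\<And>n. n \<ge> N \<Longrightarrow> x ^ n * r < 1/2"
    by (auto simp: eventually_sequentially)
  show ?thesis
  proof (rule summable_ratio_test[of "1/2" N])
    fix n assume "n \<ge> N"
    have "norm (x ^ (Suc n choose 2) * r ^ Suc n) = (x ^ n * r) * norm (x ^ (n choose 2) * r ^ n)"
      using assms by (simp add: ch power_add abs_mult mult_ac)
    also have "\<dots> \<le> 1/2 * norm (x ^ (n choose 2) * r ^ n)"
      using N[OF \<open>n \<ge> N\<close>] by (intro mult_right_mono) auto
    finally show "norm (x ^ (Suc n choose 2) * r ^ Suc n) \<le> 1/2 * norm (x ^ (n choose 2) * r ^ n)" .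
  qed simp
qed

lemma theta_abs_summable:
  assumes "q \<noteq> 0" "norm q < 1" "z \<noteq> 0"
  shows "(\<lambda>l. norm (theta_term q z l)) summable_on UNIV"
proof -
  have c: "2 * (l * (l - 1) div 2) = l * (l - 1)" for l :: int
    by simp
  have nat: "(\<lambda>n. norm q ^ (n choose 2) * r ^ n) summable_on UNIV" if "r > 0" for r
    using summable_theta_nat[of "norm q" r] assms that
    by (subst summable_on_UNIV_nonneg_real_iff) auto
  have "(\<lambda>l. norm (theta_term q z l)) summable_on {0..}"
  proof (subst summable_on_reindex_bij_witness[where j = nat and i = int and T = UNIV
        and h = "\<lambda>n. norm q ^ (n choose 2) * norm z ^ n"])
    fix l :: int assume l: "l \<in> {0..}"
    have "l * (l - 1) div 2 = int (nat l choose 2)"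
      using two_int_choose_two[of "nat l"] c[of l] l by simp
    then show "norm q ^ (nat l choose 2) * norm z ^ nat l = norm (theta_term q z l)"
      using l by (simp add: theta_term_def norm_mult norm_power norm_power_int power_int_nonneg_exp)
  qed (use nat[of "norm z"] assms in auto)
  moreover have "(\<lambda>l. norm (theta_term q z l)) summable_on {..<0}"
  \<comment> \<open>At l = -1 - n the exponent l(l-1)/2 is \<open>(n choose 2) + 2 * n + 1\<close>.
    The linear part joins the power of \<open>1 / norm z\<close>, giving the ratio
    \<open>norm q ^ 2 / norm z\<close> and the constant \<open>norm q / norm z\<close>.\<close>
  proof (subst summable_on_reindex_bij_witness[where j = "\<lambda>l. nat (-1 - l)" and i = "\<lambda>n. -1 - int n" and T = UNIV
        and h = "\<lambda>n. norm q ^ (n choose 2) * (norm q ^ 2 / norm z) ^ n * (norm q / norm z)"])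
    fix l :: int assume l: "l \<in> {..<0}"
    define n where "n = nat (-1 - l)"
    have ln: "l = - int (Suc n)"
      using l by (simp add: n_def)
    have "2 * (l * (l - 1) div 2) = 2 * int ((n choose 2) + 2 * n + 1)"
      using two_int_choose_two[of n] unfolding c ln by (simp add: algebra_simps)
    then have e: "l * (l - 1) div 2 = int ((n choose 2) + 2 * n + 1)"
      by (simp only: mult_cancel_left) simp
    have "norm (theta_term q z l) = norm q ^ ((n choose 2) + 2 * n + 1) * (1 / norm z ^ Suc n)"
      unfolding theta_term_def e unfolding ln power_int_of_nat power_int_minus_divide
      by (simp add: norm_mult norm_power norm_divide)
    also have "\<dots> = norm q ^ (n choose 2) * (norm q ^ 2 / norm z) ^ n * (norm q / norm z)"
      by (simp add: power_add power_divide power_even_eq mult_ac flip: power_mult)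
    finally show "norm q ^ (nat (-1 - l) choose 2) * (norm q ^ 2 / norm z) ^ nat (-1 - l) * (norm q / norm z) =
        norm (theta_term q z l)"
      by (simp add: n_def)
  next
    show "(\<lambda>n. norm q ^ (n choose 2) * (norm q ^ 2 / norm z) ^ n * (norm q / norm z)) summable_on UNIV"
      using nat[of "norm q ^ 2 / norm z"] assms by (intro summable_on_cmult_left) simp
  qed auto
  ultimately have "(\<lambda>l. norm (theta_term q z l)) summable_on {0..} \<union> {..<0}"
    by (rule summable_on_Un_disjoint) auto
  also have "{0..} \<union> {..<0::int} = UNIV"
    by auto
  finally show ?thesis .
qed

lemma qpoch_fin_tendsto:
  assumes "norm q < 1"
  shows "qpoch_fin z q \<longlonglongrightarrow> qpoch z q"
  using convergent_prod_LIMSEQ[OF convergent_prod_qpoch[OF assms, of z]]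
  unfolding qpoch_fin_def qpoch_def LIMSEQ_lessThan_iff_atMost .

lemma one_minus_power_nonzero:
  fixes q :: complex
  assumes "norm q < 1"
  shows "1 - q * q ^ j \<noteq> 0"
proof
  assume "1 - q * q ^ j = 0"
  then have "norm q ^ Suc j = 1"
    by (metis eq_iff_diff_eq_0 norm_one norm_power power_Suc)
  moreover have "norm q ^ Suc j < 1"
    using assms power_decreasing[of 1 "Suc j" "norm q"] by simp
  ultimately show False by simp
qed

lemma qpoch_self_nonzero: "norm q < 1 \<Longrightarrow> qpoch q q \<noteq> 0"
  unfolding qpoch_def
  by (intro prodinf_nonzero convergent_prod_qpoch one_minus_power_nonzero)

lemma qpoch_fin_self_nonzero: "norm q < 1 \<Longrightarrow> qpoch_fin q q n \<noteq> 0"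
  unfolding qpoch_fin_def using one_minus_power_nonzero[of q]
  by (simp only: prod_zero_iff finite_lessThan) blast

lemma gauss_binomial_eq_div:
  assumes "norm q < 1" "k \<le> n"
  shows "gauss_binomial q n k = qpoch_fin q q n / (qpoch_fin q q k * qpoch_fin q q (n - k))"
  using gauss_binomial_closed[OF assms(2), of q] qpoch_fin_self_nonzero[OF assms(1)]
  by (simp add: field_simps)

text \<open>The q-factorials converge to a nonzero limit, so they and their inverses are bounded.
  The bound is uniform in n and k and provides the dominating series for the limit.\<close>

lemma gauss_binomial_bounded:
  assumes "norm q < 1"
  obtains K where "\<And>n k. norm (gauss_binomial q n k) \<le> K"
proof -
  have "Bseq (qpoch_fin q q)"
    using qpoch_fin_tendsto[OF assms, of q] by (intro convergent_imp_Bseq convergentI)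
  then obtain K1 where K1: "\<And>n. norm (qpoch_fin q q n) \<le> K1" "K1 > 0"
    by (metis BseqE)
  have "Bseq (\<lambda>n. inverse (qpoch_fin q q n))"
    using tendsto_inverse[OF qpoch_fin_tendsto[OF assms, of q] qpoch_self_nonzero[OF assms]]
    by (intro convergent_imp_Bseq convergentI)
  then obtain K2 where K2: "\<And>n. norm (inverse (qpoch_fin q q n)) \<le> K2" "K2 > 0"
    by (metis BseqE)
  have "norm (gauss_binomial q n k) \<le> K1 * (K2 * K2)" for n k
  proof (cases "k \<le> n")
    case True
    have "norm (gauss_binomial q n k) = norm (qpoch_fin q q n) *
        (norm (inverse (qpoch_fin q q k)) * norm (inverse (qpoch_fin q q (n - k))))"
      by (simp add: gauss_binomial_eq_div[OF assms True] norm_mult norm_divide norm_inverse divide_inverse)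
    also have "\<dots> \<le> K1 * (K2 * K2)"
      using K1 K2 by (intro mult_mono) auto
    finally show ?thesis .
  qed (use K1 K2 in \<open>simp add: gauss_binomial_eq_0\<close>)
  then show thesis by (rule that)
qed

text \<open>For fixed l all three q-factorials in the quotient tend to \<open>qpoch q q\<close>, two
  of them in the denominator. The cut-off to 0 matters: for l < -n the truncated index
  \<open>nat (int n + l)\<close> is 0, where the Gaussian binomial is 1.\<close>

lemma central_gauss_binomial_tendsto:
  assumes "norm q < 1"
  shows "(\<lambda>n. if \<bar>l\<bar> \<le> int n then gauss_binomial q (2 * n) (nat (int n + l)) else 0)
    \<longlonglongrightarrow> 1 / qpoch q q"
proof -
  note lim = qpoch_fin_tendsto[OF assms, of q]
  have top: "filterlim (\<lambda>n. nat (int n + i)) sequentially sequentially" for i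
    unfolding filterlim_at_top
  proof
    fix Z :: nat
    show "eventually (\<lambda>n. Z \<le> nat (int n + i)) sequentially"
      using eventually_ge_at_top[of "nat (int Z - i)"] by eventually_elim auto
  qed
  have top2: "filterlim (\<lambda>n. 2 * n) sequentially sequentially"
    by (rule filterlim_subseq) (simp add: strict_mono_def)
  have "(\<lambda>n. qpoch_fin q q (2 * n) / (qpoch_fin q q (nat (int n + l)) * qpoch_fin q q (nat (int n + - l))))
      \<longlonglongrightarrow> qpoch q q / (qpoch q q * qpoch q q)"
    using qpoch_self_nonzero[OF assms]
    by (intro tendsto_divide tendsto_mult filterlim_compose[OF lim] top top2) auto
  moreover have "eventually (\<lambda>n. qpoch_fin q q (2 * n) / (qpoch_fin q q (nat (int n + l)) * qpoch_fin q q (nat (int n + - l))) =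
      (if \<bar>l\<bar> \<le> int n then gauss_binomial q (2 * n) (nat (int n + l)) else 0)) sequentially"
    using eventually_ge_at_top[of "nat \<bar>l\<bar>"]
  proof eventually_elim
    case (elim n)
    have "nat (int n + l) \<le> 2 * n" "2 * n - nat (int n + l) = nat (int n + - l)"
      using elim by linarith+
    then show ?case
      using elim by (simp add: gauss_binomial_eq_div[OF assms])
  qed
  ultimately show ?thesis
    using qpoch_self_nonzero[OF assms] by (simp add: tendsto_cong)
qed

theorem jacobi_triple_product:
  assumes "q \<noteq> 0" "norm q < 1" "z \<noteq> 0"
  shows "(theta_term q z has_sum qpoch z q * qpoch (q / z) q * qpoch q q) UNIV"
proof -
  define g where "g n l = (if \<bar>l\<bar> \<le> int n then gauss_binomial q (2 * n) (nat (int n + l)) else 0)" for n l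
  obtain K where K: "\<And>n k. norm (gauss_binomial q n k) \<le> K"
    using gauss_binomial_bounded[OF assms(2)] by blast
  have K0: "K \<ge> 0"
    using K[of 0 0] by simp
  \<comment> \<open>The finite sum becomes a sum over all integers, so that only the summand depends
    on n.\<close>
  have fin: "qpoch_fin z q n * qpoch_fin (q / z) q n = (\<Sum>\<^sub>\<infinity>l. theta_term q z l * g n l)" for n
  proof -
    have "(\<Sum>\<^sub>\<infinity>l. theta_term q z l * g n l) = (\<Sum>\<^sub>\<infinity>l\<in>{- int n..int n}. theta_term q z l * gauss_binomial q (2 * n) (nat (int n + l)))"
      by (rule infsum_cong_neutral) (auto simp: g_def)
    then show ?thesis
      by (simp add: finite_triple_product[OF assms(1,3)])
  qed
  have "(\<lambda>n. \<Sum>\<^sub>\<infinity>l. theta_term q z l * g n l) \<longlonglongrightarrow> (\<Sum>\<^sub>\<infinity>l. theta_term q z l * (1 / qpoch q q))"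
  proof (rule dominated_convergence_infsum[where g = "\<lambda>l. norm (theta_term q z l) * K"])
    show "(\<lambda>l. norm (theta_term q z l) * K) summable_on UNIV"
      by (intro summable_on_cmult_left theta_abs_summable assms)
    show "norm (theta_term q z l * g n l) \<le> norm (theta_term q z l) * K" for n l
      using K K0 by (auto simp: norm_mult g_def intro!: mult_left_mono)
    show "(\<lambda>n. theta_term q z l * g n l) \<longlonglongrightarrow> theta_term q z l * (1 / qpoch q q)" for l
      unfolding g_def by (intro tendsto_mult tendsto_const central_gauss_binomial_tendsto assms)
  qed
  then have "(\<lambda>n. qpoch_fin z q n * qpoch_fin (q / z) q n) \<longlonglongrightarrow> (\<Sum>\<^sub>\<infinity>l. theta_term q z l) * (1 / qpoch q q)"
    unfolding fin infsum_cmult_left' .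
  moreover have "(\<lambda>n. qpoch_fin z q n * qpoch_fin (q / z) q n) \<longlonglongrightarrow> qpoch z q * qpoch (q / z) q"
    by (intro tendsto_mult qpoch_fin_tendsto assms)
  ultimately have "(\<Sum>\<^sub>\<infinity>l. theta_term q z l) * (1 / qpoch q q) = qpoch z q * qpoch (q / z) q"
    by (rule LIMSEQ_unique)
  then have "(\<Sum>\<^sub>\<infinity>l. theta_term q z l) = qpoch z q * qpoch (q / z) q * qpoch q q"
    using qpoch_self_nonzero[OF assms(2)] by (simp add: field_simps)
  moreover have "theta_term q z summable_on UNIV"
    using theta_abs_summable[OF assms] by (rule abs_summable_summable)
  ultimately show ?thesis
    by (metis has_sum_infsum)
qed

subsection \<open>The quintuple product identity\<close>

text \<open>Summability of complex families is absolute, so the product family is absolutely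
  summable and may be summed iteratively.\<close>

lemma has_sum_product:
  fixes f :: "'a \<Rightarrow> complex" and g :: "'b \<Rightarrow> complex"
  assumes f: "(f has_sum a) A" and g: "(g has_sum b) B"
  shows "((\<lambda>(x, y). f x * g y) has_sum a * b) (A \<times> B)"
proof (rule has_sum_SigmaI)
  have "(\<lambda>x. norm (f x)) summable_on A" "(\<lambda>y. norm (g y)) summable_on B"
    using f g summable_on_iff_abs_summable_on_complex has_sum_imp_summable by blast+
  then have "(\<lambda>(x, y). norm (f x) * norm (g y)) summable_on A \<times> B"
    by (intro summable_on_SigmaI[where g = "\<lambda>x. norm (f x) * infsum (\<lambda>y. norm (g y)) B"])
      (auto intro!: has_sum_cmult_right has_sum_infsum summable_on_cmult_left)
  then have "(\<lambda>w. norm ((\<lambda>(x, y). f x * g y) w)) summable_on A \<times> B"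
    by (simp add: case_prod_unfold norm_mult)
  then show "(\<lambda>(x, y). f x * g y) summable_on A \<times> B"
    by (rule abs_summable_summable)
qed (use assms in \<open>auto intro!: has_sum_cmult_right has_sum_cmult_left\<close>)

text \<open>The factors of the finite product of length 3n are grouped by the residue of the
  exponent modulo 3; then n tends to infinity.\<close>

lemma qpoch_trisect:
  assumes "norm q < 1"
  shows "qpoch q q = qpoch q (q ^ 3) * qpoch (q ^ 2) (q ^ 3) * qpoch (q ^ 3) (q ^ 3)"
proof -
  have 3: "norm (q ^ 3) < 1"
    using assms power_decreasing[of 1 3 "norm q"] by (simp add: norm_power)
  have fin: "qpoch_fin q q (3 * n) =
      qpoch_fin q (q ^ 3) n * qpoch_fin (q ^ 2) (q ^ 3) n * qpoch_fin (q ^ 3) (q ^ 3) n" for n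
  proof (induction n)
    case (Suc n)
    have "qpoch_fin q q (3 * Suc n) = qpoch_fin q q (3 * n) *
        ((1 - q * q ^ (3 * n)) * (1 - q * q ^ Suc (3 * n)) * (1 - q * q ^ Suc (Suc (3 * n))))"
      by (simp add: qpoch_fin_Suc mult.assoc numeral_3_eq_3)
    also have "\<dots> = qpoch_fin q q (3 * n) *
        ((1 - q * (q ^ 3) ^ n) * (1 - q ^ 2 * (q ^ 3) ^ n) * (1 - q ^ 3 * (q ^ 3) ^ n))"
      by (simp add: power_mult power2_eq_square power3_eq_cube mult.assoc)
    finally show ?case
      unfolding Suc by (simp add: qpoch_fin_Suc mult_ac)
  qed simp
  have "(\<lambda>n. qpoch_fin q q (3 * n)) \<longlonglongrightarrow> qpoch q q"
    by (rule filterlim_compose[OF qpoch_fin_tendsto[OF assms]])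
      (rule filterlim_subseq, simp add: strict_mono_def)
  moreover have "(\<lambda>n. qpoch_fin q q (3 * n)) \<longlonglongrightarrow>
      qpoch q (q ^ 3) * qpoch (q ^ 2) (q ^ 3) * qpoch (q ^ 3) (q ^ 3)"
    unfolding fin by (intro tendsto_mult qpoch_fin_tendsto 3)
  ultimately show ?thesis
    by (rule LIMSEQ_unique)
qed

section \<open>The coefficients of the quintuple product\<close>

definition quintuple_sign :: "int \<Rightarrow> complex" where
  "quintuple_sign l = (if l mod 3 = 0 then 1 else if l mod 3 = 1 then - 1 else 0)"

text \<open>The division by 6 is inexact exactly when l is 2 modulo 3, and there the sign is 0, so
  rounding does no harm.\<close>

definition quintuple_term :: "complex \<Rightarrow> complex \<Rightarrow> int \<Rightarrow> complex" where
  "quintuple_term q z l = quintuple_sign l * q powi (l * (l - 1) div 6) * z powi l"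

lemma div_six:
  assumes "l mod 3 \<noteq> 2"
  shows "6 * (l * (l - 1) div 6) = l * (l - 1 :: int)"
proof -
  have "l mod 3 = 0 \<or> (l - 1) mod 3 = 0"
    using assms by presburger
  then have "3 dvd l * (l - 1)"
    by (auto simp flip: dvd_eq_mod_eq_0)
  moreover have "2 dvd l * (l - 1)"
    by simp
  ultimately have "6 dvd l * (l - 1)"
    using divides_mult[of 3 "l * (l - 1)" 2] by simp
  then show ?thesis
    by (rule dvd_mult_div_cancel)
qed

lemma div_two: "2 * (l * (l - 1) div 2) = l * (l - 1 :: int)"
  by simp

lemma powi_minus_left: "(- x) powi k = (if even k then 1 else - 1) * (x :: complex) powi k"
  by (simp add: power_int_minus_left)

text \<open>These are the pairs of terms of the two theta series contributing to the power l of
  \<open>z\<close>. As a function of j the exponent is quadratic with leading term 3j^2, so their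
  sum is again a theta series, in base \<open>q ^ 6\<close>.\<close>

lemma theta_term_product:
  assumes "q \<noteq> 0" "z \<noteq> 0"
  shows "theta_term q z (l - 2 * j) * theta_term (q\<^sup>2) (q * z\<^sup>2) j =
    (if even (l + j) then 1 else - 1) * q powi (l * (l - 1) div 2 + 3 * j * j - (2 * l - 1) * j) * z powi l"
proof -
  let ?i = "l - 2 * j"
  have "2 * (?i * (?i - 1) div 2 + 2 * (j * (j - 1) div 2) + j) =
      2 * (l * (l - 1) div 2 + 3 * j * j - (2 * l - 1) * j)"
    unfolding distrib_left right_diff_distrib[of 2] div_two by (simp add: algebra_simps)
  then have e: "l * (l - 1) div 2 + 3 * j * j - (2 * l - 1) * j =
      ?i * (?i - 1) div 2 + 2 * (j * (j - 1) div 2) + j"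
    by simp
  have q: "q powi (l * (l - 1) div 2 + 3 * j * j - (2 * l - 1) * j) =
      q powi (?i * (?i - 1) div 2) * (q\<^sup>2) powi (j * (j - 1) div 2) * q powi j"
    unfolding e using assms by (simp add: power_int_add power_int_power)
  have "l = ?i + 2 * j"
    by simp
  then have z: "z powi l = z powi ?i * (z\<^sup>2) powi j"
    using assms by (metis power_int_add power_int_power of_nat_numeral)
  show ?thesis
    unfolding q z theta_term_def powi_minus_left power_int_mult_distrib by simp
qed

text \<open>Euler's pentagonal number theorem for \<open>q\<^sup>2\<close>: the triple product with
  base \<open>q ^ 6\<close> at \<open>q ^ 4\<close>, whose three factors are the trisection of
  \<open>qpoch (q\<^sup>2) (q\<^sup>2)\<close>.\<close>

lemma has_sum_theta_pentagonal:
  assumes "q \<noteq> 0" "norm q < 1"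
  shows "((\<lambda>j. (if even j then 1 else - 1) * q powi (3 * j * j + j)) has_sum qpoch (q\<^sup>2) (q\<^sup>2)) UNIV"
proof -
  have n: "norm (q ^ k) < 1" if "k > 0" for k
    using assms power_decreasing[of 1 k "norm q"] that by (simp add: norm_power)
  have "theta_term (q ^ 6) (q ^ 4) j = (if even j then 1 else - 1) * q powi (3 * j * j + j)" for j
  proof -
    have e: "3 * j * j + j = 6 * (j * (j - 1) div 2) + 4 * j"
    proof -
      define t where "t = j * (j - 1) div 2"
      have "2 * t = j * (j - 1)"
        unfolding t_def by (rule div_two)
      then show ?thesis
        unfolding t_def[symmetric] by (simp add: algebra_simps)
    qed
    show ?thesis
      using assms unfolding theta_term_def powi_minus_left e
      by (simp add: power_int_power power_int_add)
  qed
  then have th: "theta_term (q ^ 6) (q ^ 4) = (\<lambda>j. (if even j then 1 else - 1) * q powi (3 * j * j + j))"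
    by blast
  have "q ^ 6 / q ^ 4 = q\<^sup>2"
    using assms by (simp add: field_simps flip: power_add)
  moreover have "qpoch (q\<^sup>2) (q\<^sup>2) = qpoch (q\<^sup>2) (q ^ 6) * qpoch (q ^ 4) (q ^ 6) * qpoch (q ^ 6) (q ^ 6)"
    using qpoch_trisect[OF n[of 2]] by (simp flip: power_mult)
  ultimately show ?thesis
    using jacobi_triple_product[of "q ^ 6" "q ^ 4"] assms n[of 6] by (simp add: th mult_ac)
qed

text \<open>The exponent 3j^2 - (2l-1)j has its vertex at (2l-1)/6. For l = 3n, 3n+1, 3n+2 this is n
  - 1/6, n + 1/6, n + 1/2, so the series is a shifted pentagonal series, a reflected one, or
  antisymmetric.\<close>

lemma quintuple_inner_sum:
  assumes q: "q \<noteq> 0" "norm q < 1" and z: "z \<noteq> 0"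
    and summable: "(\<lambda>j. theta_term q z (l - 2 * j) * theta_term (q\<^sup>2) (q * z\<^sup>2) j) summable_on UNIV"
  shows "((\<lambda>j. theta_term q z (l - 2 * j) * theta_term (q\<^sup>2) (q * z\<^sup>2) j) has_sum
    quintuple_term q z l * qpoch (q\<^sup>2) (q\<^sup>2)) UNIV"
proof -
  let ?f = "\<lambda>j. theta_term q z (l - 2 * j) * theta_term (q\<^sup>2) (q * z\<^sup>2) j"
  let ?s = "\<lambda>j. (if even j then 1 else - 1) * q powi (3 * j * j + j)"
  define n where "n = l div 3"
  consider "l = 3 * n" | "l = 3 * n + 1" | "l = 3 * n + 2"
  proof -
    have "l = 3 * n \<or> l = 3 * n + 1 \<or> l = 3 * n + 2"
      unfolding n_def by presburger
    then show thesis
      using that by blast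
  qed
  then show ?thesis
  proof cases
    case 1
    have "?f (j + n) = quintuple_term q z l * ?s j" for j
    proof -
      have e: "l * (l - 1) div 2 + 3 * (j + n) * (j + n) - (2 * l - 1) * (j + n) =
          l * (l - 1) div 6 + (3 * j * j + j)"
      proof -
        define t u where "t = l * (l - 1) div 2" and "u = l * (l - 1) div 6"
        have "l mod 3 \<noteq> 2"
          using 1 by presburger
        then have "2 * t = l * (l - 1)" "6 * u = l * (l - 1)"
          unfolding t_def u_def using div_two[of l] div_six[of l] by blast+
        then show ?thesis
          unfolding t_def[symmetric] u_def[symmetric] using 1 by (simp add: algebra_simps)
      qed
      have "even (l + (j + n)) \<longleftrightarrow> even j"
        using 1 by simp
      then show ?thesis
        unfolding theta_term_product[OF q(1) z] e quintuple_term_def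
        using q 1 by (simp add: power_int_add quintuple_sign_def)
    qed
    then have "((\<lambda>j. ?f (j + n)) has_sum quintuple_term q z l * qpoch (q\<^sup>2) (q\<^sup>2)) UNIV"
      using has_sum_cmult_right[OF has_sum_theta_pentagonal[OF q]] by simp
    moreover have "bij_betw (\<lambda>j. j + n) UNIV UNIV"
      by (rule bij_betw_byWitness[where f' = "\<lambda>j. j - n"]) auto
    ultimately show ?thesis
      by (subst (asm) has_sum_reindex_bij_betw)
  next
    case 2
    have "?f (n - j) = quintuple_term q z l * ?s j" for j
    proof -
      have e: "l * (l - 1) div 2 + 3 * (n - j) * (n - j) - (2 * l - 1) * (n - j) =
          l * (l - 1) div 6 + (3 * j * j + j)"
      proof -
        define t u where "t = l * (l - 1) div 2" and "u = l * (l - 1) div 6"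
        have "l mod 3 \<noteq> 2"
          using 2 by presburger
        then have "2 * t = l * (l - 1)" "6 * u = l * (l - 1)"
          unfolding t_def u_def using div_two[of l] div_six[of l] by blast+
        then show ?thesis
          unfolding t_def[symmetric] u_def[symmetric] using 2 by (simp add: algebra_simps)
      qed
      have "even (l + (n - j)) \<longleftrightarrow> odd j"
        using 2 by simp
      moreover have "l mod 3 = 1"
        using 2 by presburger
      ultimately show ?thesis
        unfolding theta_term_product[OF q(1) z] e quintuple_term_def
        using q by (simp add: power_int_add quintuple_sign_def)
    qed
    then have "((\<lambda>j. ?f (n - j)) has_sum quintuple_term q z l * qpoch (q\<^sup>2) (q\<^sup>2)) UNIV"
      using has_sum_cmult_right[OF has_sum_theta_pentagonal[OF q]] by simp
    moreover have "bij_betw (\<lambda>j. n - j) UNIV UNIV"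
      by (rule bij_betw_byWitness[where f' = "\<lambda>j. n - j"]) auto
    ultimately show ?thesis
      by (subst (asm) has_sum_reindex_bij_betw)
  next
    case 3
    \<comment> \<open>Reflection in the vertex n + 1/2 preserves the exponent but flips the parity
      of j, hence the sign.\<close>
    have "?f (2 * n + 1 - j) = - ?f j" for j
    proof -
      have e: "l * (l - 1) div 2 + 3 * (2 * n + 1 - j) * (2 * n + 1 - j) - (2 * l - 1) * (2 * n + 1 - j) =
          l * (l - 1) div 2 + 3 * j * j - (2 * l - 1) * j"
        using 3 by (simp add: algebra_simps)
      have "even (l + (2 * n + 1 - j)) \<longleftrightarrow> odd (l + j)"
        by simp
      then show ?thesis
        unfolding theta_term_product[OF q(1) z] e by simp
    qed
    moreover have "bij_betw (\<lambda>j. 2 * n + 1 - j) UNIV UNIV"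
      by (rule bij_betw_byWitness[where f' = "\<lambda>j. 2 * n + 1 - j"]) auto
    ultimately have "infsum ?f UNIV = - infsum ?f UNIV"
      using infsum_reindex_bij_betw[of "\<lambda>j. 2 * n + 1 - j" UNIV UNIV ?f] by (simp add: infsum_uminus)
    then have "infsum ?f UNIV = 0"
      by (simp add: equal_neg_zero)
    moreover have "l mod 3 = 2"
      using 3 by presburger
    then have "quintuple_term q z l = 0"
      by (simp add: quintuple_term_def quintuple_sign_def)
    \<comment> \<open>A vanishing \<open>infsum\<close> could be the default value of a non-summable
      family; the summability assumption rules this out.\<close>
    ultimately show ?thesis
      using has_sum_infsum[OF summable] by simp
  qed
qed

text \<open>The product of the two theta series is sorted by the total power l = i + 2j of
  \<open>z\<close>. The second triple product brings an extra factor
  \<open>qpoch (q\<^sup>2) (q\<^sup>2)\<close>, which also comes out of every inner sum and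
  cancels.\<close>

theorem quintuple_product_identity:
  assumes q: "q \<noteq> 0" "norm q < 1" and z: "z \<noteq> 0"
  shows "(quintuple_term q z has_sum quintuple z q) UNIV"
proof -
  let ?f = "\<lambda>(i, j). theta_term q z i * theta_term (q\<^sup>2) (q * z\<^sup>2) j"
  have q2: "norm (q\<^sup>2) < 1"
    using q power_decreasing[of 1 2 "norm q"] by (simp add: norm_power)
  have "q\<^sup>2 / (q * z\<^sup>2) = q / z\<^sup>2"
    using q by (simp add: power2_eq_square)
  then have "(?f has_sum quintuple z q * qpoch (q\<^sup>2) (q\<^sup>2)) (UNIV \<times> UNIV)"
    using has_sum_product[OF jacobi_triple_product[OF q z] jacobi_triple_product[of "q\<^sup>2" "q * z\<^sup>2"]] q q2 z
    by (simp add: quintuple_def qpoch_list_def mult_ac)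
  then have "((\<lambda>w. ?f ((\<lambda>(l, j). (l - 2 * j, j)) w)) has_sum quintuple z q * qpoch (q\<^sup>2) (q\<^sup>2)) (UNIV \<times> UNIV)"
  proof (rule has_sum_reindex_bij_betw[THEN iffD2, rotated])
    show "bij_betw (\<lambda>(l, j). (l - 2 * j, j)) (UNIV \<times> UNIV) (UNIV \<times> (UNIV :: int set))"
    by (rule bij_betw_byWitness[where f' = "\<lambda>(i, j). (i + 2 * j, j)"]) auto
  qed
  then have *: "((\<lambda>(l, j). theta_term q z (l - 2 * j) * theta_term (q\<^sup>2) (q * z\<^sup>2) j) has_sum
      quintuple z q * qpoch (q\<^sup>2) (q\<^sup>2)) (UNIV \<times> UNIV)"
    by (simp only: case_prod_unfold fst_conv snd_conv)
  have "((\<lambda>l. quintuple_term q z l * qpoch (q\<^sup>2) (q\<^sup>2)) has_sum quintuple z q * qpoch (q\<^sup>2) (q\<^sup>2)) UNIV"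
    using *
  proof (rule has_sum_SigmaD)
    fix l
    have "(\<lambda>j. theta_term q z (l - 2 * j) * theta_term (q\<^sup>2) (q * z\<^sup>2) j) summable_on UNIV"
      using summable_on_SigmaD1[OF has_sum_imp_summable[OF *], of l] by simp
    from quintuple_inner_sum[OF q z this]
    show "((\<lambda>j. case (l, j) of (l, j) \<Rightarrow> theta_term q z (l - 2 * j) * theta_term (q\<^sup>2) (q * z\<^sup>2) j)
        has_sum quintuple_term q z l * qpoch (q\<^sup>2) (q\<^sup>2)) UNIV"
      by simp
  qed
  then show ?thesis
    using qpoch_self_nonzero[OF q2] by (simp add: has_sum_cmult_left_iff)
qed

subsection \<open>The rotated lattice\<close>

text \<open>If p divided m, it would divide n as well, and then p^2 would divide p.\<close>

lemma coprime_sum_two_squares: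
  fixes p :: nat and m n :: int
  assumes "prime p" and "int p = m\<^sup>2 + n\<^sup>2"
  shows "coprime (int p) m"
proof (rule prime_imp_coprime)
  show p: "prime (int p)"
    using assms(1) by simp
  show "\<not> int p dvd m"
  proof
    assume m: "int p dvd m"
    then have "int p dvd m\<^sup>2 + n\<^sup>2" "int p dvd m\<^sup>2"
      by (simp_all flip: assms(2)) (simp add: power2_eq_square)
    then have "int p dvd n\<^sup>2"
      using dvd_add_right_iff by blast
    then have "int p dvd n"
      using p prime_dvd_power by blast
    with m have "int p * int p dvd m\<^sup>2 + n\<^sup>2"
      unfolding power2_eq_square by (intro dvd_add mult_dvd_mono)
    then have "int p * int p dvd int p * 1"
      by (simp add: assms(2))
    then have "int p dvd 1"
      using p by (subst (asm) dvd_mult_cancel_left) auto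
    with p show False
      by (simp add: not_prime_unit)
  qed
qed

lemma rotation_bij:
  fixes p :: nat and m n e :: int
  assumes "prime p" "int p = m\<^sup>2 + n\<^sup>2" "coprime (int p) 3" "e * e = 1"
  shows "bij_betw (\<lambda>(k, s, t). (e * (m * s - n * t) + 3 * k, e * (n * s + m * t)))
    ({0..int p - 1} \<times> UNIV \<times> UNIV) (UNIV \<times> UNIV)"
proof -
  have pos: "int p > 0"
    using assms(1) prime_gt_0_nat by auto
  have cop: "coprime (int p) m"
    using assms by (intro coprime_sum_two_squares)
  then have cop3: "coprime (3 * m) (int p)"
    using assms(3) by (simp add: coprime_commute)
  \<comment> \<open>The transposed matrix inverts the rotation up to the factor p, since the two
    matrices multiply to p times the identity.\<close>
  have s_eq: "int p * s = e * (m * (i - 3 * k) + n * j)" and t_eq: "int p * t = e * (m * j - n * (i - 3 * k))"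
    if "i = e * (m * s - n * t) + 3 * k" "j = e * (n * s + m * t)" for i j k s t
  proof -
    have "e * (m * (i - 3 * k) + n * j) = (e * e) * ((m\<^sup>2 + n\<^sup>2) * s)"
      unfolding that by (simp add: algebra_simps power2_eq_square)
    then show "int p * s = e * (m * (i - 3 * k) + n * j)"
      by (simp add: assms)
    have "e * (m * j - n * (i - 3 * k)) = (e * e) * ((m\<^sup>2 + n\<^sup>2) * t)"
      unfolding that by (simp add: algebra_simps power2_eq_square)
    then show "int p * t = e * (m * j - n * (i - 3 * k))"
      by (simp add: assms)
  qed
  show ?thesis
  proof (rule bij_betw_imageI)
    show "inj_on (\<lambda>(k, s, t). (e * (m * s - n * t) + 3 * k, e * (n * s + m * t)))
        ({0..int p - 1} \<times> UNIV \<times> UNIV)"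
    proof (rule inj_onI)
      fix w w' :: "int \<times> int \<times> int"
      obtain k s t k' s' t' where w: "w = (k, s, t)" "w' = (k', s', t')"
        by (metis prod_cases3)
      assume "w \<in> {0..int p - 1} \<times> UNIV \<times> UNIV" "w' \<in> {0..int p - 1} \<times> UNIV \<times> UNIV"
        and eq: "(\<lambda>(k, s, t). (e * (m * s - n * t) + 3 * k, e * (n * s + m * t))) w =
          (\<lambda>(k, s, t). (e * (m * s - n * t) + 3 * k, e * (n * s + m * t))) w'"
      then have k: "k \<in> {0..int p - 1}" "k' \<in> {0..int p - 1}"
        by (simp_all add: w)
      from eq have i: "e * (m * s - n * t) + 3 * k = e * (m * s' - n * t') + 3 * k'"
        and j: "e * (n * s + m * t) = e * (n * s' + m * t')"
        unfolding w prod.case by blast+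
      note E1 = s_eq[OF refl refl, of s t k] t_eq[OF refl refl, of t s k]
      note E2 = s_eq[OF i j] t_eq[OF i j]
      \<comment> \<open>Comparing the two formulas for s shows that k is determined modulo p,
        because 3m is invertible; the range of k then fixes it.\<close>
      have "3 * m * (k - k') = int p * (e * (s' - s))"
      proof -
        have "int p * s' - int p * s = e * (3 * m * (k - k'))"
          unfolding E1(1) E2(1) by (simp add: algebra_simps)
        then have "e * (int p * s' - int p * s) = (e * e) * (3 * m * (k - k'))"
          by simp
        then show ?thesis
          by (simp add: assms algebra_simps)
      qed
      then have "int p dvd 3 * m * (k - k')"
        by simp
      then have "int p dvd k - k'"
        using cop3 by (simp add: coprime_commute coprime_dvd_mult_right_iff)
      then have kk: "k = k'"
        using k zdvd_imp_le[of "int p" "k - k'"] zdvd_imp_le[of "int p" "k' - k"]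
        by (cases k k' rule: linorder_cases) (auto simp: dvd_diff_commute)
      with E1 E2 have "int p * s = int p * s'" "int p * t = int p * t'"
        by simp_all
      with kk pos show "w = w'"
        by (simp add: w)
    qed
    show "(\<lambda>(k, s, t). (e * (m * s - n * t) + 3 * k, e * (n * s + m * t))) `
        ({0..int p - 1} \<times> UNIV \<times> UNIV) = UNIV \<times> UNIV"
    proof (intro equalityI subsetI)
      fix w :: "int \<times> int"
      obtain i j where w: "w = (i, j)"
        by (cases w)
      obtain x where x: "[3 * m * x = 1] (mod int p)"
        using cong_solve_coprime_int[OF cop3] by blast
      \<comment> \<open>Integrality of s requires 3mk to be congruent to mi + nj modulo p; this k
        solves that congruence with the inverse \<open>x\<close> of 3m.\<close>
      define k where "k = x * (m * i + n * j) mod int p"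
      have k: "k \<in> {0..int p - 1}"
        using pos by (simp add: k_def)
      have "[3 * m * k = 3 * m * (x * (m * i + n * j))] (mod int p)"
        unfolding k_def by (intro cong_mult cong_refl) (simp add: cong_def)
      also have "3 * m * (x * (m * i + n * j)) = (3 * m * x) * (m * i + n * j)"
        by (simp add: mult_ac)
      also have "[(3 * m * x) * (m * i + n * j) = 1 * (m * i + n * j)] (mod int p)"
        by (intro cong_mult x cong_refl)
      finally have "int p dvd (m * i + n * j) - 3 * m * k"
        by (metis cong_iff_dvd_diff cong_sym mult_1)
      then have "int p dvd m * (i - 3 * k) + n * j"
        by (simp add: algebra_simps)
      then obtain s' where s': "m * (i - 3 * k) + n * j = int p * s'"
        by blast
      \<comment> \<open>Integrality of t needs no further choice: modulo p, m times its numerator is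
        -n times the numerator of s, and m can be cancelled.\<close>
      have "m * (m * j - n * (i - 3 * k)) = (m\<^sup>2 + n\<^sup>2) * j - n * (m * (i - 3 * k) + n * j)"
        by (simp add: algebra_simps power2_eq_square)
      also have "\<dots> = int p * (j - n * s')"
        unfolding s' assms(2)[symmetric] by (simp add: algebra_simps)
      finally have "int p dvd m * (m * j - n * (i - 3 * k))"
        by simp
      then have "int p dvd m * j - n * (i - 3 * k)"
        using cop by (simp add: coprime_dvd_mult_right_iff)
      then obtain t' where t': "m * j - n * (i - 3 * k) = int p * t'"
        by blast
      have "int p * (m * s' - n * t') = m * (m * (i - 3 * k) + n * j) - n * (m * j - n * (i - 3 * k))"
        unfolding s' t' by (simp add: algebra_simps)
      also have "\<dots> = (m\<^sup>2 + n\<^sup>2) * (i - 3 * k)"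
        by (simp add: algebra_simps power2_eq_square)
      finally have "m * s' - n * t' = i - 3 * k"
        using pos by (simp flip: assms(2))
      moreover have "int p * (n * s' + m * t') = n * (m * (i - 3 * k) + n * j) + m * (m * j - n * (i - 3 * k))"
        unfolding s' t' by (simp add: algebra_simps)
      then have "int p * (n * s' + m * t') = (m\<^sup>2 + n\<^sup>2) * j"
        by (simp add: algebra_simps power2_eq_square)
      then have "n * s' + m * t' = j"
        using pos by (simp flip: assms(2))
      \<comment> \<open>\<open>s'\<close> and \<open>t'\<close> solve the system without the sign;
        multiplying both by \<open>e\<close> absorbs it.\<close>
      moreover have "e * (m * (e * s') - n * (e * t')) = (e * e) * (m * s' - n * t')"
        "e * (n * (e * s') + m * (e * t')) = (e * e) * (n * s' + m * t')"
        by (simp_all add: algebra_simps)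
      ultimately have "w = (e * (m * (e * s') - n * (e * t')) + 3 * k, e * (n * (e * s') + m * (e * t')))"
        by (simp add: w assms)
      then show "w \<in> (\<lambda>(k, s, t). (e * (m * s - n * t) + 3 * k, e * (n * s + m * t))) `
          ({0..int p - 1} \<times> UNIV \<times> UNIV)"
        using k by (intro image_eqI[of _ _ "(k, e * s', e * t')"]) auto
    qed simp
  qed
qed

section \<open>Exponents and signs under the rotation\<close>

text \<open>All exponents are multiplied by 6 to stay in the integers. The rotation scales the
  quadratic form by P, and the linear form mi + nj becomes \<open>e * P * s + 3 * k * m\<close>,
  free of t; hence \<open>b\<close> enters the coefficient of s but not that of t.\<close>

lemma rotation_exponents:
  fixes P m n b e k s t i j :: int
  assumes P: "P = m * m + n * n" and e: "e * e = 1"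
    and i: "i = e * (m * s - n * t) + 3 * k" and j: "j = e * (n * s + m * t)"
  shows "P * (i * (i - 1)) + 6 * b * m * i + P * (j * (j - 1)) + 6 * b * n * j =
    3 * (6 * b * k * m + k * (3 * k - 1) * P) + P * P * (s * (s - 1)) +
    P * (6 * e * (b + k * m) + P - e * (m + n)) * s + P * P * (t * (t - 1)) +
    P * (P - 6 * e * k * n - e * (m - n)) * t"
proof -
  define x y where "x = m * s - n * t" and "y = n * s + m * t"
  have "i * i + j * j = (e * e) * (x * x + y * y) + 6 * e * k * x + 9 * k * k"
    by (simp add: i j x_def y_def algebra_simps)
  moreover have "x * x + y * y = P * (s * s + t * t)"
    by (simp add: P x_def y_def algebra_simps)
  ultimately have sq: "i * i + j * j = P * (s * s + t * t) + 6 * e * k * x + 9 * k * k"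
    by (simp add: e)
  have lin: "m * i + n * j = e * P * s + 3 * k * m"
    by (simp add: P i j algebra_simps)
  have "P * (i * (i - 1)) + 6 * b * m * i + P * (j * (j - 1)) + 6 * b * n * j =
      P * (i * i + j * j) - P * (i + j) + 6 * b * (m * i + n * j)"
    by (simp add: algebra_simps)
  also have "\<dots> = P * (P * (s * s + t * t) + 6 * e * k * (m * s - n * t) + 9 * k * k)
      - P * (e * (m * s - n * t) + 3 * k + e * (n * s + m * t)) + 6 * b * (e * P * s + 3 * k * m)"
    unfolding sq lin unfolding i j x_def ..
  finally show ?thesis
    by (simp add: algebra_simps)
qed

text \<open>Since \<open>e * m\<close> is 1 and \<open>n\<close> is 0 modulo 3, the substitution
  preserves both indices modulo 3, so the signs agree; the exponents agree by
  \<open>rotation_exponents\<close>.\<close>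

lemma rotation_term:
  fixes p :: nat and m n b e k s t A B G :: int and q :: complex
  assumes q: "q \<noteq> 0" and p: "int p = m\<^sup>2 + n\<^sup>2" and e: "e = 1 \<or> e = - 1"
    and mod3: "e * m mod 3 = 1" "n mod 3 = 0"
    and A: "6 * A = int p * (6 * e * (b + k * m) + int p - e * (m + n))"
    and B: "6 * B = int p * (int p - 6 * e * k * n - e * (m - n))"
    and G: "2 * G = 6 * b * k * m + k * (3 * k - 1) * int p"
  shows "quintuple_term (q ^ p) (q powi (b * m)) (e * (m * s - n * t) + 3 * k) *
      quintuple_term (q ^ p) (q powi (b * n)) (e * (n * s + m * t)) =
    q powi G * (quintuple_term (q ^ p\<^sup>2) (q powi A) s * quintuple_term (q ^ p\<^sup>2) (q powi B) t)"
proof -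
  define i j where "i = e * (m * s - n * t) + 3 * k" and "j = e * (n * s + m * t)"
  obtain u where u: "e * m = 3 * u + 1"
    using mod3(1) by (metis mult_div_mod_eq)
  obtain v where v: "n = 3 * v"
    using mod3(2) by (metis mult_div_mod_eq add.right_neutral)
  have "i = s + 3 * (u * s - e * v * t + k)"
    using arg_cong[OF u, of "\<lambda>x. x * s"] by (simp add: i_def v algebra_simps)
  then have is_mod: "i mod 3 = s mod 3"
    by (metis mod_mult_self2)
  have "j = t + 3 * (u * t + e * v * s)"
    using arg_cong[OF u, of "\<lambda>x. x * t"] by (simp add: j_def v algebra_simps)
  then have jt: "j mod 3 = t mod 3"
    by (metis mod_mult_self2)
  have ee: "e * e = 1"
    using e by auto
  show ?thesis
  \<comment> \<open>In the first case both sides vanish; excluding it makes all four divisions by 6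
    exact.\<close>
  proof (cases "s mod 3 = 2 \<or> t mod 3 = 2")
    case True
    then show ?thesis
      using is_mod jt by (auto simp: quintuple_term_def quintuple_sign_def i_def j_def)
  next
    case False
    define i' j' s' t' where "i' = i * (i - 1) div 6" and "j' = j * (j - 1) div 6"
      and "s' = s * (s - 1) div 6" and "t' = t * (t - 1) div 6"
    have six: "6 * i' = i * (i - 1)" "6 * j' = j * (j - 1)" "6 * s' = s * (s - 1)" "6 * t' = t * (t - 1)"
      unfolding i'_def j'_def s'_def t'_def by (rule div_six, use False is_mod jt in simp)+
    have "6 * (int p * i' + b * m * i + (int p * j' + b * n * j)) =
        int p * (6 * i') + 6 * b * m * i + int p * (6 * j') + 6 * b * n * j"
      by (simp add: algebra_simps)
    also have "\<dots> = 3 * (2 * G) + int p * int p * (6 * s') + 6 * A * s + int p * int p * (6 * t') + 6 * B * t"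
      unfolding six A B G rotation_exponents[OF p[unfolded power2_eq_square] ee i_def j_def] ..
    also have "\<dots> = 6 * (G + (int p * int p * s' + A * s + (int p * int p * t' + B * t)))"
      by (simp add: algebra_simps)
    finally have exps: "int p * i' + b * m * i + (int p * j' + b * n * j) =
        G + (int p * int p * s' + A * s + (int p * int p * t' + B * t))"
      by simp
    have term_eq: "quintuple_term (q ^ c) (q powi x) l =
        quintuple_sign l * q powi (int c * (l * (l - 1) div 6) + x * l)" for c x l
      using q by (simp add: quintuple_term_def power_int_add power_int_power flip: power_int_mult)
    have "quintuple_term (q ^ p) (q powi (b * m)) i * quintuple_term (q ^ p) (q powi (b * n)) j =
        quintuple_sign i * quintuple_sign j * q powi (int p * i' + b * m * i + (int p * j' + b * n * j))"
      using q unfolding term_eq i'_def j'_def by (simp add: power_int_add)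
    also have "\<dots> = quintuple_sign s * quintuple_sign t *
        q powi (G + (int p * int p * s' + A * s + (int p * int p * t' + B * t)))"
      unfolding exps using is_mod jt by (simp add: quintuple_sign_def)
    also have "\<dots> = q powi G * (quintuple_term (q ^ p\<^sup>2) (q powi A) s * quintuple_term (q ^ p\<^sup>2) (q powi B) t)"
      using q unfolding term_eq s'_def t'_def by (simp add: power_int_add power2_eq_square)
    finally show ?thesis
      by (simp add: i_def j_def)
  qed
qed

text \<open>The sign \<open>e\<close> treats both residue classes of m at once. Replacing
  \<open>e\<close> by its negative turns (\<alpha> - p^2)/3 into (2p^2 - \<alpha>)/3 and (2p^2 -
  \<beta>)/3 into (\<beta> - p^2)/3; the assumptions on \<open>A\<close>, \<open>B\<close>,
  \<open>G\<close> state these exponents without denominators.\<close>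

lemma quintuple_product_expansion:
  fixes p :: nat and m n b e :: int and A B G :: "int \<Rightarrow> int" and q :: complex
  assumes "prime p" and "[p = 1] (mod 12)" and p: "int p = m\<^sup>2 + n\<^sup>2" and e: "e = 1 \<or> e = - 1"
    and mod3: "e * m mod 3 = 1" "n mod 3 = 0"
    and q: "q \<noteq> 0" "norm q < 1"
    and A: "\<And>k. 6 * A k = int p * (6 * e * (b + k * m) + int p - e * (m + n))"
    and B: "\<And>k. 6 * B k = int p * (int p - 6 * e * k * n - e * (m - n))"
    and G: "\<And>k. 2 * G k = 6 * b * k * m + k * (3 * k - 1) * int p"
  shows "quintuple (q powi (b * m)) (q ^ p) * quintuple (q powi (b * n)) (q ^ p) =
    (\<Sum>k = 0..int p - 1. q powi G k * quintuple (q powi A k) (q ^ p\<^sup>2) * quintuple (q powi B k) (q ^ p\<^sup>2))"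
    (is "?L = _")
proof -
  have norm: "norm (q ^ k) < 1" if "k > 0" for k
    using q power_decreasing[of 1 k "norm q"] that by (simp add: norm_power)
  have p0: "p > 0" "p\<^sup>2 > 0"
    using assms(1) prime_gt_0_nat by auto
  have "p mod 12 = 1"
    using assms(2) by (simp add: cong_def)
  then have "p mod 3 = 1"
    by presburger
  then have "\<not> 3 dvd int p"
    by presburger
  then have cop: "coprime (int p) 3"
    using prime_imp_coprime[of "3 :: int" "int p"] by (simp add: coprime_commute)
  have Q: "(quintuple_term (q ^ c) (q powi x) has_sum quintuple (q powi x) (q ^ c)) UNIV" if "c > 0" for c x
    using q norm[OF that] by (intro quintuple_product_identity) auto
  have "((\<lambda>(i, j). quintuple_term (q ^ p) (q powi (b * m)) i * quintuple_term (q ^ p) (q powi (b * n)) j)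
      has_sum ?L) (UNIV \<times> UNIV)"
    by (intro has_sum_product Q p0)
  then have "((\<lambda>(k, s, t). quintuple_term (q ^ p) (q powi (b * m)) (e * (m * s - n * t) + 3 * k) *
      quintuple_term (q ^ p) (q powi (b * n)) (e * (n * s + m * t))) has_sum ?L)
      ({0..int p - 1} \<times> UNIV \<times> UNIV)"
    using rotation_bij[OF assms(1) p cop, of e] e
    by (subst (asm) has_sum_reindex_bij_betw[symmetric, of "\<lambda>(k, s, t). (e * (m * s - n * t) + 3 * k, e * (n * s + m * t))"
          "{0..int p - 1} \<times> UNIV \<times> UNIV"]) (auto simp: case_prod_unfold)
  then have "((\<lambda>(k, w). q powi G k * (case w of (s, t) \<Rightarrow>
        quintuple_term (q ^ p\<^sup>2) (q powi A k) s * quintuple_term (q ^ p\<^sup>2) (q powi B k) t)) has_sum ?L)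
      ({0..int p - 1} \<times> UNIV \<times> UNIV)"
    by (simp add: rotation_term[OF q(1) p e mod3 A B G] case_prod_unfold)
  \<comment> \<open>For fixed k the double sum over (s, t) factors into two quintuple
    series.\<close>
  then have "((\<lambda>k. q powi G k * (quintuple (q powi A k) (q ^ p\<^sup>2) * quintuple (q powi B k) (q ^ p\<^sup>2))) has_sum ?L)
      {0..int p - 1}"
  proof (rule has_sum_SigmaD)
    fix k
    show "((\<lambda>w. case (k, w) of (k, w) \<Rightarrow> q powi G k * (case w of (s, t) \<Rightarrow>
        quintuple_term (q ^ p\<^sup>2) (q powi A k) s * quintuple_term (q ^ p\<^sup>2) (q powi B k) t)) has_sum
        q powi G k * (quintuple (q powi A k) (q ^ p\<^sup>2) * quintuple (q powi B k) (q ^ p\<^sup>2))) (UNIV \<times> UNIV)"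
      unfolding prod.case by (intro has_sum_cmult_right has_sum_product Q p0)
  qed
  then show ?thesis
    by (simp add: has_sum_finite_iff mult.assoc)
qed

section \<open>The two residue classes of m\<close>

lemma floor_eq_of_Ints: "x \<in> \<int> \<Longrightarrow> of_int \<lfloor>x :: rat\<rfloor> = x"
  by (auto elim: Ints_cases)

theorem theorem3p1:
  fixes p :: nat and m n b :: int and q :: complex
  assumes "prime p" and "[p = 1] (mod 12)"
    and "int p = m\<^sup>2 + n\<^sup>2" and "3 dvd n"
    and "b > 0"
    and "0 < norm q" and "norm q < 1"
  shows "([m = 1] (mod 3) \<longrightarrow>
            quintuple (q powi (b * m)) (q ^ p) * quintuple (q powi (b * n)) (q ^ p) =
            (\<Sum>k = 0..int p - 1. q powi \<lfloor>gamma p m b k\<rfloor>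
               * quintuple (q powi \<lfloor>(alpha p m n b k - (of_nat p)\<^sup>2) / 3\<rfloor>) (q ^ p\<^sup>2)
               * quintuple (q powi \<lfloor>(2 * (of_nat p)\<^sup>2 - beta p m n k) / 3\<rfloor>) (q ^ p\<^sup>2)))
       \<and> ([m = 2] (mod 3) \<longrightarrow>
            quintuple (q powi (b * m)) (q ^ p) * quintuple (q powi (b * n)) (q ^ p) =
            (\<Sum>k = 0..int p - 1. q powi \<lfloor>gamma p m b k\<rfloor>
               * quintuple (q powi \<lfloor>(2 * (of_nat p)\<^sup>2 - alpha p m n b k) / 3\<rfloor>) (q ^ p\<^sup>2)
               * quintuple (q powi \<lfloor>(beta p m n k - (of_nat p)\<^sup>2) / 3\<rfloor>) (q ^ p\<^sup>2)))"
proof (intro conjI impI)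
  have q: "q \<noteq> 0" "norm q < 1"
    using assms by auto
  have n: "n mod 3 = 0"
    using assms(4) by presburger
  have G: "2 * \<lfloor>gamma p m b k\<rfloor> = 6 * b * k * m + k * (3 * k - 1) * int p" for k
  proof -
    have "of_int (2 * \<lfloor>gamma p m b k\<rfloor>) = (of_int (6 * b * k * m + k * (3 * k - 1) * int p) :: rat)"
      by (simp add: floor_eq_of_Ints[OF gamma_Ints]) (simp add: gamma_def field_simps)
    then show ?thesis
      by (simp only: of_int_eq_iff)
  qed
  {
    assume m: "[m = 1] (mod 3)"
    note ints = exponents_Ints_1[OF assms(2-4) m, THEN floor_eq_of_Ints]
    \<comment> \<open>The explicit factor 1 makes unification choose \<open>e = 1\<close>; in the
      other case the factor is - 1.\<close>
    have em: "1 * m mod 3 = 1"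
      using m by (simp add: cong_def)
    show "quintuple (q powi (b * m)) (q ^ p) * quintuple (q powi (b * n)) (q ^ p) =
            (\<Sum>k = 0..int p - 1. q powi \<lfloor>gamma p m b k\<rfloor>
               * quintuple (q powi \<lfloor>(alpha p m n b k - (of_nat p)\<^sup>2) / 3\<rfloor>) (q ^ p\<^sup>2)
               * quintuple (q powi \<lfloor>(2 * (of_nat p)\<^sup>2 - beta p m n k) / 3\<rfloor>) (q ^ p\<^sup>2))"
    proof (rule quintuple_product_expansion[OF assms(1-3) _ em n q _ _ G])
      fix k
      have "of_int (6 * \<lfloor>(alpha p m n b k - (of_nat p)\<^sup>2) / 3\<rfloor>) =
          (of_int (int p * (6 * 1 * (b + k * m) + int p - 1 * (m + n))) :: rat)"
        unfolding of_int_mult ints by (simp add: alpha_def power2_eq_square field_simps)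
      then show "6 * \<lfloor>(alpha p m n b k - (of_nat p)\<^sup>2) / 3\<rfloor> =
          int p * (6 * 1 * (b + k * m) + int p - 1 * (m + n))"
        by (simp only: of_int_eq_iff)
      have "of_int (6 * \<lfloor>(2 * (of_nat p)\<^sup>2 - beta p m n k) / 3\<rfloor>) =
          (of_int (int p * (int p - 6 * 1 * k * n - 1 * (m - n))) :: rat)"
        unfolding of_int_mult ints by (simp add: beta_def power2_eq_square field_simps)
      then show "6 * \<lfloor>(2 * (of_nat p)\<^sup>2 - beta p m n k) / 3\<rfloor> =
          int p * (int p - 6 * 1 * k * n - 1 * (m - n))"
        by (simp only: of_int_eq_iff)
    qed simp
  }
  {
    assume m: "[m = 2] (mod 3)"
    note ints = exponents_Ints_2[OF assms(2-4) m, THEN floor_eq_of_Ints]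
    have "m mod 3 = 2"
      using m by (simp add: cong_def)
    then have em: "- 1 * m mod 3 = 1"
      by presburger
    show "quintuple (q powi (b * m)) (q ^ p) * quintuple (q powi (b * n)) (q ^ p) =
            (\<Sum>k = 0..int p - 1. q powi \<lfloor>gamma p m b k\<rfloor>
               * quintuple (q powi \<lfloor>(2 * (of_nat p)\<^sup>2 - alpha p m n b k) / 3\<rfloor>) (q ^ p\<^sup>2)
               * quintuple (q powi \<lfloor>(beta p m n k - (of_nat p)\<^sup>2) / 3\<rfloor>) (q ^ p\<^sup>2))"
    proof (rule quintuple_product_expansion[OF assms(1-3) _ em n q _ _ G])
      fix k
      have "of_int (6 * \<lfloor>(2 * (of_nat p)\<^sup>2 - alpha p m n b k) / 3\<rfloor>) =
          (of_int (int p * (6 * - 1 * (b + k * m) + int p - - 1 * (m + n))) :: rat)"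
        unfolding of_int_mult ints by (simp add: alpha_def power2_eq_square field_simps)
      then show "6 * \<lfloor>(2 * (of_nat p)\<^sup>2 - alpha p m n b k) / 3\<rfloor> =
          int p * (6 * - 1 * (b + k * m) + int p - - 1 * (m + n))"
        by (simp only: of_int_eq_iff)
      have "of_int (6 * \<lfloor>(beta p m n k - (of_nat p)\<^sup>2) / 3\<rfloor>) =
          (of_int (int p * (int p - 6 * - 1 * k * n - - 1 * (m - n))) :: rat)"
        unfolding of_int_mult ints by (simp add: beta_def power2_eq_square field_simps)
      then show "6 * \<lfloor>(beta p m n k - (of_nat p)\<^sup>2) / 3\<rfloor> =
          int p * (int p - 6 * - 1 * k * n - - 1 * (m - n))"
        by (simp only: of_int_eq_iff)
    qed simp
  }
qed

end
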